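(* Let $\mathcal{N}=\{1,\dots,N\}$ and fix a total charging power $P_{\mathrm{c}}>0$. Consider the non-cooperative transmission rate determination game in which each worker $i\in\mathcal{N}$ chooses $r_i\ge 0$ to maximize $$\bar u_i(r_i,\mathbf{r}_{-i},P_{\mathrm{c}})=\frac{r_i}{\sum_{j\in\mathcal{N}}r_j}P_{\mathrm{c}}-\frac{2^{r_i/B}-1}{g}D_i^{\alpha}-b_ir_i .$$ (1) Existence. $\bar u_i$ is strictly concave in $r_i$, so the game is a concave game, and a Nash equilibrium exists when $\sum_{j\in\mathcal{N}\setminus\{i\}}r_j>0$; otherwise worker $i$'s best strategy does not exist. For any strategy profile $\mathbf{r}_{-i}$ with $\sum_{j\in\mathcal{N}\setminus\{i\}}r_j>0$, worker $i$'s best response strategy exists and is unique. (2) Uniqueness. Let $\mathbf{H}$ be the $N\times N$ matrix function with entries $\mathbf{H}_{ij}=\frac{\partial^2\bar u_i}{\partial r_i\partial r_j}$, $i,j\in\mathcal{N}$. If $r_i\le\sum_{k\in\mathcal{N}\setminus\{i\}}r_k$ for all $i\in\mathcal{N}$, then $\mathbf{H}+\mathbf{H}^{\mathrm{T}}$ is strictly negative definite, and hence the Nash equilibrium of the game is unique; that is, once $P_{\mathrm{c}}$ is fixed, the workers' transmission rates are uniquely determined.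
   Context: Workers $1,\dots,N$ play a non-cooperative game. Worker $i$'s strategy is its data transmission rate $r_i\ge 0$; $\mathbf{r}_{-i}$ denotes the vector of the other workers' rates. The first term of $\bar u_i$ is the share of the total charging power $P_{\mathrm{c}}$ given to worker $i$, proportional to its rate. $B>0$ is the channel bandwidth, $g>0$ the channel gain to noise ratio, $\alpha\ge 2$ the path-loss exponent, $D_i>0$ the maximum possible distance of worker $i$ from the base station, and $b_i>0$ worker $i$'s sensing energy cost per bit. Given $P_{\mathrm{c}}$, a Nash equilibrium is a strategy vector $\mathbf{r}^{\mathrm{ne}}=(r_1^{\mathrm{ne}},\dots,r_N^{\mathrm{ne}})$ such that no worker can improve its utility by unilaterally changing its own strategy while the other workers' strategies are kept unchanged. A game is called concave if each worker $i$ chooses $r_i$ to maximize a utility $\bar u_i$ that is concave in $r_i$. $\mathbf{H}^{\mathrm{T}}$ denotes the transpose of $\mathbf{H}$. *)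

theory Defs
  imports "HOL-Analysis.Analysis"
begin

text \<open>The workers are the elements of a finite type \<open>'n\<close>, so \<open>N = CARD('n)\<close>. A strategy profile
  is a function \<open>r :: 'n \<Rightarrow> real\<close>, and \<open>r(i := x)\<close> is the profile in which worker \<open>i\<close> plays \<open>x\<close>
  and the others play \<open>r\<^sub>-\<^sub>i\<close>.\<close>

definition profiles :: "('n \<Rightarrow> real) set" where
  "profiles = {r. \<forall>i. 0 \<le> r i}"

definition rate_of_others :: "('n::finite \<Rightarrow> real) \<Rightarrow> 'n \<Rightarrow> real" where
  "rate_of_others r i = (\<Sum>j\<in>UNIV - {i}. r j)"

text \<open>At the zero profile the power share is \<open>0/0\<close>, which is \<open>0\<close> in HOL: a worker who
  transmits nothing receives no power.\<close>

definition worker_utility ::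
  "real \<Rightarrow> real \<Rightarrow> real \<Rightarrow> real \<Rightarrow> ('n::finite \<Rightarrow> real) \<Rightarrow> ('n \<Rightarrow> real) \<Rightarrow> 'n \<Rightarrow> ('n \<Rightarrow> real) \<Rightarrow> real" where
  "worker_utility Pc B g \<alpha> D b i r =
     r i / (\<Sum>j\<in>UNIV. r j) * Pc - (2 powr (r i / B) - 1) / g * D i powr \<alpha> - b i * r i"

definition best_response ::
  "('n \<Rightarrow> ('n \<Rightarrow> real) \<Rightarrow> real) \<Rightarrow> 'n \<Rightarrow> ('n \<Rightarrow> real) \<Rightarrow> real \<Rightarrow> bool" where
  "best_response u i r x \<longleftrightarrow> 0 \<le> x \<and> (\<forall>y\<ge>0. u i (r(i := y)) \<le> u i (r(i := x)))"

definition nash_equilibrium ::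
  "('n \<Rightarrow> ('n \<Rightarrow> real) \<Rightarrow> real) \<Rightarrow> ('n \<Rightarrow> real) \<Rightarrow> bool" where
  "nash_equilibrium u r \<longleftrightarrow> r \<in> profiles \<and> (\<forall>i. \<forall>y\<ge>0. u i (r(i := y)) \<le> u i r)"

definition strictly_concave_on :: "real set \<Rightarrow> (real \<Rightarrow> real) \<Rightarrow> bool" where
  "strictly_concave_on S f \<longleftrightarrow> convex S \<and>
     (\<forall>x\<in>S. \<forall>y\<in>S. \<forall>t. x \<noteq> y \<and> 0 < t \<and> t < 1 \<longrightarrow>
        (1 - t) * f x + t * f y < f ((1 - t) * x + t * y))"

definition concave_game :: "('n \<Rightarrow> ('n \<Rightarrow> real) \<Rightarrow> real) \<Rightarrow> bool" where
  "concave_game u \<longleftrightarrow> (\<forall>i. \<forall>r\<in>profiles. concave_on {0..} (\<lambda>x. u i (r(i := x))))"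

definition partial_deriv :: "'n \<Rightarrow> (('n \<Rightarrow> real) \<Rightarrow> real) \<Rightarrow> ('n \<Rightarrow> real) \<Rightarrow> real" where
  "partial_deriv j f r = deriv (\<lambda>t. f (r(j := t))) (r j)"

text \<open>The derivatives are two-sided also where \<open>r i = 0\<close>: the formula defining the utility makes
  sense for all real rates, and is smooth where the total rate is positive.\<close>

definition second_partials ::
  "('n::finite \<Rightarrow> ('n \<Rightarrow> real) \<Rightarrow> real) \<Rightarrow> ('n \<Rightarrow> real) \<Rightarrow> real ^ 'n ^ 'n" where
  "second_partials u r = (\<chi> i j. partial_deriv i (partial_deriv j (u i)) r)"

definition negative_definite :: "real ^ 'n ^ 'n \<Rightarrow> bool" where
  "negative_definite A \<longleftrightarrow> transpose A = A \<and> (\<forall>x. x \<noteq> 0 \<longrightarrow> x \<bullet> (A *v x) < 0)"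

end

theory Submission
  imports Defs
begin

text \<open>Write \<open>S\<close> for the total rate. Multiplying the first-order condition of worker \<open>i\<close> by \<open>S\<close> turns it into a
  complementarity problem for its share \<open>p = r\<^sub>i / S\<close> alone, with a left-hand side that strictly
  decreases in both \<open>p\<close> and \<open>S\<close>. So \<open>S\<close> determines every share, the shares depend continuously
  and monotonically on \<open>S\<close>, and the equilibria are the \<open>S > 0\<close> for which the shares sum to \<open>1\<close>.
  At \<open>S = 0\<close> all shares are \<open>1\<close> and for large \<open>S\<close> they vanish, so with at least two workers
  there is exactly one such \<open>S\<close>.

  For the Hessian, put \<open>X = \<Sum>i. x\<^sub>i\<close>. Up to the contribution of the energy costs, which is negative,
  the quadratic form of \<open>H\<close> at \<open>x\<close> is a positive multiple of
  \<open>2 X (r \<bullet> x) / S - X\<^sup>2 - x \<bullet> x\<close>, which is at most \<open>(r \<bullet> x / S)\<^sup>2 - x \<bullet> x \<le> 0\<close>.\<close>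

section \<open>Profiles, concavity and quadratic forms in general\<close>

lemma rate_of_others_nonneg: "r \<in> profiles \<Longrightarrow> 0 \<le> rate_of_others r i"
  unfolding rate_of_others_def profiles_def by (auto intro: sum_nonneg)

lemma rate_of_others_upd [simp]: "rate_of_others (r(i := x)) i = rate_of_others r i"
  unfolding rate_of_others_def by (rule sum.cong) auto

lemma sum_UNIV_eq_rate_of_others: "(\<Sum>j\<in>UNIV. r j) = rate_of_others r i + r i"
  unfolding rate_of_others_def by (simp add: sum.remove [of UNIV i])

lemma nash_equilibrium_iff_best_response:
  "nash_equilibrium u r \<longleftrightarrow> r \<in> profiles \<and> (\<forall>i. best_response u i r (r i))"
  by (auto simp: nash_equilibrium_def best_response_def profiles_def)

lemma strictly_concave_on_imp_concave_on:
  assumes "strictly_concave_on S f"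
  shows "concave_on S f"
  unfolding concave_on_def
proof (rule convex_onI)
  show "convex S" using assms by (simp add: strictly_concave_on_def)
  fix t x y :: real
  assume t: "0 < t" "t < 1" and xy: "x \<in> S" "y \<in> S"
  show "- f ((1 - t) *\<^sub>R x + t *\<^sub>R y) \<le> (1 - t) * - f x + t * - f y"
  proof (cases "x = y")
    case True
    then show ?thesis by (simp add: algebra_simps)
  next
    case False
    then have "(1 - t) * f x + t * f y < f ((1 - t) * x + t * y)"
      using assms t xy unfolding strictly_concave_on_def by blast
    then show ?thesis by simp
  qed
qed

text \<open>The gap to the tangent is
  \<open>s * (y - x)\<^sup>2 / ((s + x)\<^sup>2 * (s + y))\<close>. The bound includes
  \<open>s = 0\<close>, where the share jumps from \<open>0\<close> (the value of
  \<open>0 / 0\<close>) to \<open>1\<close>, and the tangent is the constant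
  \<open>1\<close>.\<close>

lemma power_share_le_tangent:
  fixes s x y :: real
  assumes "0 \<le> s" "0 \<le> y" "0 < s + x"
  shows "y / (s + y) \<le> x / (s + x) + s / (s + x)\<^sup>2 * (y - x)"
proof (cases "s + y = 0")
  case True
  then have "s = 0" "y = 0" using assms by auto
  then show ?thesis using assms by simp
next
  case False
  then have *: "0 < s + y" using assms by linarith
  have "x / (s + x) + s / (s + x)\<^sup>2 * (y - x) - y / (s + y) = s * (y - x)\<^sup>2 / ((s + x)\<^sup>2 * (s + y))"
    using * assms(3) by (simp add: divide_simps) algebra
  also have "\<dots> \<ge> 0" using * assms by simp
  finally show ?thesis by simp
qed

lemma quadratic_form_transpose:
  fixes A :: "real ^ 'n ^ 'n"
  shows "x \<bullet> (transpose A *v x) = x \<bullet> (A *v x)"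
  by (metis dot_lmul_matrix inner_commute transpose_matrix_vector)

lemma quadratic_form_eq_sum:
  fixes A :: "real ^ 'n ^ 'n"
  shows "x \<bullet> (A *v x) = (\<Sum>i\<in>UNIV. \<Sum>j\<in>UNIV. x $ i * (A $ i $ j * x $ j))"
  by (simp add: inner_vec_def matrix_vector_mult_def sum_distrib_left)

text \<open>Cauchy-Schwarz, combined with the fact that for nonnegative entries the Euclidean norm
  is at most the sum of the entries.\<close>

lemma sum_mult_squared_le:
  fixes r x :: "'n::finite \<Rightarrow> real"
  assumes "r \<in> profiles"
  shows "(\<Sum>i\<in>UNIV. r i * x i)\<^sup>2 \<le> (\<Sum>i\<in>UNIV. r i)\<^sup>2 * (\<Sum>i\<in>UNIV. (x i)\<^sup>2)"
proof -
  have r: "\<And>i. 0 \<le> r i" using assms by (simp add: profiles_def)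
  have "(\<Sum>i\<in>UNIV. r i * x i)\<^sup>2 \<le> (\<Sum>i\<in>UNIV. (r i)\<^sup>2) * (\<Sum>i\<in>UNIV. (x i)\<^sup>2)"
    by (rule Cauchy_Schwarz_ineq_sum)
  moreover have "(\<Sum>i\<in>UNIV. (r i)\<^sup>2) \<le> (\<Sum>i\<in>UNIV. r i)\<^sup>2"
  proof -
    have "(\<Sum>i\<in>UNIV. (r i)\<^sup>2) \<le> (\<Sum>i\<in>UNIV. r i * (\<Sum>j\<in>UNIV. r j))"
      unfolding power2_eq_square
      by (intro sum_mono mult_left_mono member_le_sum) (auto simp: r)
    then show ?thesis by (simp add: power2_eq_square sum_distrib_right)
  qed
  ultimately show ?thesis
    by (meson mult_right_mono order_trans sum_nonneg zero_le_power2)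
qed

section \<open>The energy cost of a worker and its derivatives\<close>

locale rate_game =
  fixes Pc B g \<alpha> :: real and D b :: "'n::finite \<Rightarrow> real"
  assumes Pc_pos: "0 < Pc" and B_pos: "0 < B" and g_pos: "0 < g"
    and D_pos: "\<And>i. 0 < D i" and b_pos: "\<And>i. 0 < b i"
begin

abbreviation utility where "utility \<equiv> worker_utility Pc B g \<alpha> D b"

definition cost :: "'n \<Rightarrow> real \<Rightarrow> real" where
  "cost i x = (2 powr (x / B) - 1) / g * D i powr \<alpha> + b i * x"

definition marginal_cost :: "'n \<Rightarrow> real \<Rightarrow> real" where
  "marginal_cost i x = 2 powr (x / B) * (ln 2 / B) / g * D i powr \<alpha> + b i"

definition cost_curvature :: "'n \<Rightarrow> real \<Rightarrow> real" where
  "cost_curvature i x = 2 powr (x / B) * (ln 2 / B)\<^sup>2 / g * D i powr \<alpha>"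

lemma cost_zero [simp]: "cost i 0 = 0"
  by (simp add: cost_def)

lemma powr_rate_has_derivative:
  "((\<lambda>x. 2 powr (x / B)) has_real_derivative 2 powr (x / B) * (ln 2 / B)) (at x)"
  unfolding powr_def using B_pos by (auto intro!: derivative_eq_intros)

lemma cost_has_derivative: "(cost i has_real_derivative marginal_cost i x) (at x)"
  unfolding cost_def [abs_def] marginal_cost_def
  using B_pos g_pos by (auto intro!: derivative_eq_intros powr_rate_has_derivative)

lemma marginal_cost_has_derivative:
  "(marginal_cost i has_real_derivative cost_curvature i x) (at x)"
  unfolding cost_curvature_def marginal_cost_def [abs_def]
  using B_pos g_pos
  by (auto intro!: derivative_eq_intros powr_rate_has_derivative simp: power2_eq_square mult_ac)

lemma cost_curvature_pos: "0 < cost_curvature i x"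
  using B_pos g_pos D_pos [of i] by (simp add: cost_curvature_def)

lemma marginal_cost_gt: "b i < marginal_cost i x"
  using B_pos g_pos D_pos [of i] by (simp add: marginal_cost_def)

lemma marginal_cost_pos: "0 < marginal_cost i x"
  using marginal_cost_gt [of i x] b_pos [of i] by linarith

lemma marginal_cost_strict_mono: "x < y \<Longrightarrow> marginal_cost i x < marginal_cost i y"
  by (erule DERIV_pos_imp_increasing) (metis marginal_cost_has_derivative cost_curvature_pos)

lemma marginal_cost_mono: "x \<le> y \<Longrightarrow> marginal_cost i x \<le> marginal_cost i y"
  using marginal_cost_strict_mono [of x y i] by (cases "x = y") auto

lemma continuous_on_cost: "continuous_on A (cost i)"
  by (rule DERIV_continuous_on) (rule has_field_derivative_at_within [OF cost_has_derivative])

lemma continuous_on_marginal_cost: "continuous_on A (marginal_cost i)"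
  by (rule DERIV_continuous_on) (rule has_field_derivative_at_within [OF marginal_cost_has_derivative])

lemma cost_strict_mono: "x < y \<Longrightarrow> cost i x < cost i y"
  by (erule DERIV_pos_imp_increasing) (metis cost_has_derivative marginal_cost_pos)

text \<open>Strict convexity: by the mean value theorem the secant slope is a marginal cost at an
  intermediate point, and marginal cost strictly increases.\<close>

lemma cost_gt_tangent:
  assumes "x \<noteq> y"
  shows "cost i x + marginal_cost i x * (y - x) < cost i y"
proof (cases "x < y")
  case True
  then obtain z where "x < z" "cost i y - cost i x = (y - x) * marginal_cost i z"
    using MVT2 [of x y "cost i" "marginal_cost i"] cost_has_derivative by blast
  moreover from this have "(y - x) * marginal_cost i x < (y - x) * marginal_cost i z"
    using marginal_cost_strict_mono [of x z i] True by simp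
  ultimately show ?thesis by (simp add: algebra_simps)
next
  case False
  then have "y < x" using assms by simp
  then obtain z where "z < x" "cost i x - cost i y = (x - y) * marginal_cost i z"
    using MVT2 [of y x "cost i" "marginal_cost i"] cost_has_derivative by blast
  moreover from this have "(x - y) * marginal_cost i z < (x - y) * marginal_cost i x"
    using marginal_cost_strict_mono [of z x i] \<open>y < x\<close> by simp
  ultimately show ?thesis by (simp add: algebra_simps)
qed

section \<open>The payoff of one worker against a fixed total rate of the others\<close>

definition payoff :: "'n \<Rightarrow> real \<Rightarrow> real \<Rightarrow> real" where
  "payoff i s x = x / (s + x) * Pc - cost i x"

definition marginal_payoff :: "'n \<Rightarrow> real \<Rightarrow> real \<Rightarrow> real" where
  "marginal_payoff i s x = Pc * s / (s + x)\<^sup>2 - marginal_cost i x"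

text \<open>The other workers enter only through their total rate, so every unilateral deviation is
  a question about one real function.\<close>

lemma utility_upd: "utility i (r(i := x)) = payoff i (rate_of_others r i) x"
  unfolding worker_utility_def payoff_def cost_def
  by (subst sum_UNIV_eq_rate_of_others [of _ i]) simp

lemma payoff_has_derivative:
  assumes "0 < s + x"
  shows "(payoff i s has_real_derivative marginal_payoff i s x) (at x)"
proof -
  have "((\<lambda>x. x / (s + x) * Pc) has_real_derivative Pc * s / (s + x)\<^sup>2) (at x)"
    by (rule derivative_eq_intros refl | use assms in \<open>simp add: divide_simps power2_eq_square\<close>)+
  from DERIV_diff [OF this cost_has_derivative] show ?thesis
    by (simp add: payoff_def [abs_def] marginal_payoff_def)
qed

text \<open>A concave power share minus a strictly convex cost. This global bound yields both strict
  concavity and the sufficiency of the first-order condition.\<close>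

lemma payoff_lt_tangent:
  assumes "0 \<le> s" "0 \<le> y" "0 < s + x" "x \<noteq> y"
  shows "payoff i s y < payoff i s x + marginal_payoff i s x * (y - x)"
proof -
  have "y / (s + y) * Pc \<le> (x / (s + x) + s / (s + x)\<^sup>2 * (y - x)) * Pc"
    using power_share_le_tangent [of s y x] assms Pc_pos by (intro mult_right_mono) auto
  then show ?thesis
    using cost_gt_tangent [OF assms(4), of i]
    by (simp add: payoff_def marginal_payoff_def algebra_simps)
qed

text \<open>Both endpoints lie strictly below the tangent at the intermediate point
  \<open>z\<close>; averaging the two bounds cancels the slope.\<close>

lemma strictly_concave_payoff:
  assumes "0 \<le> s"
  shows "strictly_concave_on {0..} (payoff i s)"
  unfolding strictly_concave_on_def
proof (intro conjI ballI allI impI)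
  fix x y t :: real
  assume x: "x \<in> {0..}" and y: "y \<in> {0..}" and t: "x \<noteq> y \<and> 0 < t \<and> t < 1"
  define z where "z = (1 - t) * x + t * y"
  define m where "m = marginal_payoff i s z"
  \<comment> \<open>A proper convex combination of distinct nonnegative rates is positive, so the
    tangent bound applies at \<open>z\<close> even when \<open>s = 0\<close>.\<close>
  have "0 < z"
  proof (cases "x = 0")
    case True
    then show ?thesis using x y t by (simp add: z_def)
  next
    case False
    then show ?thesis using x y t by (simp add: z_def add_pos_nonneg)
  qed
  moreover have "z - x = t * (y - x)" "y - z = (1 - t) * (y - x)"
    by (simp_all add: z_def algebra_simps)
  then have "z \<noteq> x" "z \<noteq> y" using t by auto
  ultimately have "payoff i s x < payoff i s z + m * (x - z)" "payoff i s y < payoff i s z + m * (y - z)"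
    using payoff_lt_tangent [of s _ z i] assms x y by (auto simp: m_def)
  then have "(1 - t) * payoff i s x + t * payoff i s y
      < (1 - t) * (payoff i s z + m * (x - z)) + t * (payoff i s z + m * (y - z))"
    using t by (intro add_strict_mono mult_strict_left_mono) auto
  also have "\<dots> = payoff i s z" by (simp add: z_def algebra_simps)
  finally show "(1 - t) * payoff i s x + t * payoff i s y < payoff i s ((1 - t) * x + t * y)"
    by (simp add: z_def)
qed simp

lemma strictly_concave_utility:
  "r \<in> profiles \<Longrightarrow> strictly_concave_on {0..} (\<lambda>x. utility i (r(i := x)))"
  using strictly_concave_payoff [OF rate_of_others_nonneg] by (simp add: utility_upd)

lemma concave_game_utility: "concave_game utility"
  unfolding concave_game_def
proof (intro allI ballI)
  fix i :: 'n and r :: "'n \<Rightarrow> real"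
  assume "r \<in> profiles"
  then show "concave_on {0..} (\<lambda>x. utility i (r(i := x)))"
    by (intro strictly_concave_on_imp_concave_on strictly_concave_utility)
qed

section \<open>Best responses\<close>

lemma best_response_utility_iff:
  "best_response utility i r x \<longleftrightarrow>
    0 \<le> x \<and> (\<forall>y\<ge>0. payoff i (rate_of_others r i) y \<le> payoff i (rate_of_others r i) x)"
  by (simp add: best_response_def utility_upd)

text \<open>Against silent opponents any positive rate wins all of \<open>Pc\<close>. Halving a
  positive rate therefore only saves cost, while rate \<open>0\<close> wins nothing and loses to any
  rate that costs less than \<open>Pc\<close>.\<close>

lemma no_best_response:
  assumes "r \<in> profiles" "\<not> 0 < rate_of_others r i"
  shows "\<not> best_response utility i r x"
proof
  have s: "rate_of_others r i = 0"
    using assms rate_of_others_nonneg [of r i] by linarith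
  assume "best_response utility i r x"
  then have x: "0 \<le> x" and max: "\<And>y. 0 \<le> y \<Longrightarrow> payoff i 0 y \<le> payoff i 0 x"
    by (auto simp: best_response_utility_iff s)
  show False
  proof (cases "x = 0")
    case True
    have "(cost i \<longlongrightarrow> 0) (at_right 0)"
      using DERIV_isCont [OF cost_has_derivative [of i 0]]
      by (simp add: isCont_def filterlim_at_split)
    then have "eventually (\<lambda>y. cost i y < Pc) (at_right 0)"
      using Pc_pos by (rule order_tendstoD)
    then obtain y where "0 < y" "cost i y < Pc"
      using eventually_happens' [OF trivial_limit_at_right_real
          eventually_conj [OF _ eventually_at_right_less]] by blast
    then show False using max [of y] True by (simp add: payoff_def)
  next
    case False
    then have "cost i (x / 2) < cost i x"
      using x by (intro cost_strict_mono) simp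
    then show False using max [of "x / 2"] x False by (simp add: payoff_def)
  qed
qed

text \<open>Existence by compactness, since large rates cannot pay off; uniqueness because the
  midpoint of two maximizers would do strictly better.\<close>

lemma ex1_best_response:
  assumes "0 < rate_of_others r i"
  shows "\<exists>!x. best_response utility i r x"
proof (rule ex_ex1I)
  define s where "s = rate_of_others r i"
  have s: "0 < s" using assms by (simp add: s_def)
  \<comment> \<open>Sending more than \<open>Pc / b i\<close> costs more in sensing energy alone
    than the whole power \<open>Pc\<close>, which is worse than rate \<open>0\<close>.\<close>
  define M where "M = Pc / b i"
  have M: "0 \<le> M" using Pc_pos b_pos [of i] by (simp add: M_def)
  have "continuous_on {0..M} (payoff i s)"
    unfolding payoff_def [abs_def] using s
    by (intro continuous_intros continuous_on_cost) auto
  then obtain x where x: "x \<in> {0..M}" "\<forall>y\<in>{0..M}. payoff i s y \<le> payoff i s x"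
    using continuous_attains_sup [of "{0..M}" "payoff i s"] M by fastforce
  have "payoff i s y \<le> payoff i s x" if "0 \<le> y" for y
  proof (cases "y \<le> M")
    case True
    then show ?thesis using x that by auto
  next
    case False
    have "y / (s + y) * Pc \<le> 1 * Pc"
      using s that Pc_pos by (intro mult_right_mono) auto
    moreover have "Pc < b i * y"
      using False b_pos [of i] by (simp add: M_def divide_simps mult.commute)
    moreover have "0 + marginal_cost i 0 * y \<le> cost i y"
      using cost_gt_tangent [of 0 y i] by (cases "y = 0") auto
    moreover have "b i * y \<le> marginal_cost i 0 * y"
      using marginal_cost_gt [of i 0] that by (intro mult_right_mono) auto
    ultimately have "payoff i s y \<le> payoff i s 0"
      by (simp add: payoff_def)
    also have "\<dots> \<le> payoff i s x" using x(2) M by simp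
    finally show ?thesis .
  qed
  then show "\<exists>x. best_response utility i r x"
    using x by (auto simp: best_response_utility_iff s_def)
next
  fix x y
  assume *: "best_response utility i r x" "best_response utility i r y"
  show "x = y"
  proof (rule ccontr)
    assume "x \<noteq> y"
    define f where "f = payoff i (rate_of_others r i)"
    have x: "0 \<le> x" "\<And>z. 0 \<le> z \<Longrightarrow> f z \<le> f x" and y: "0 \<le> y" "\<And>z. 0 \<le> z \<Longrightarrow> f z \<le> f y"
      using * by (auto simp: best_response_utility_iff f_def)
    have "strictly_concave_on {0..} f"
      unfolding f_def using assms by (intro strictly_concave_payoff) simp
    moreover have "x \<in> {0..}" "y \<in> {0..}" "(0::real) < 1/2" "1/2 < (1::real)"
      using x y by auto
    ultimately have "(1 - 1/2) * f x + 1/2 * f y < f ((1 - 1/2) * x + 1/2 * y)"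
      using \<open>x \<noteq> y\<close> unfolding strictly_concave_on_def by blast
    moreover have "f ((1 - 1/2) * x + 1/2 * y) \<le> f x"
      using x y by simp
    moreover have "f x \<le> f y" using x y by simp
    ultimately show False by simp
  qed
qed

text \<open>A positive derivative would allow a profitable increase, and at a positive rate the
  maximum is interior. Conversely, complementarity turns the tangent bound into global
  optimality.\<close>

lemma best_response_iff_first_order:
  assumes "0 < rate_of_others r i"
  shows "best_response utility i r x \<longleftrightarrow>
    0 \<le> x \<and> marginal_payoff i (rate_of_others r i) x \<le> 0 \<and>
    x * marginal_payoff i (rate_of_others r i) x = 0"
    (is "_ \<longleftrightarrow> ?F")
proof
  define s where "s = rate_of_others r i"
  have s: "0 < s" using assms by (simp add: s_def)
  {
    assume "best_response utility i r x"
    then have x: "0 \<le> x" and max: "\<And>y. 0 \<le> y \<Longrightarrow> payoff i s y \<le> payoff i s x"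
      by (auto simp: best_response_utility_iff s_def)
    have d: "(payoff i s has_real_derivative marginal_payoff i s x) (at x)"
      using s x by (intro payoff_has_derivative) simp
    have "marginal_payoff i s x \<le> 0"
    proof (rule ccontr)
      assume "\<not> ?thesis"
      then obtain e where "0 < e" "\<And>h. 0 < h \<Longrightarrow> h < e \<Longrightarrow> payoff i s x < payoff i s (x + h)"
        using DERIV_pos_inc_right [OF d] by auto
      then have "payoff i s x < payoff i s (x + e / 2)" by simp
      then show False using max [of "x + e / 2"] x \<open>0 < e\<close> by simp
    qed
    \<comment> \<open>The neighbourhood of radius \<open>x\<close> around \<open>x\<close> contains
      only nonnegative rates, so \<open>x\<close> is a two-sided local maximum.\<close>
    moreover have "marginal_payoff i s x = 0" if "x \<noteq> 0"
      using DERIV_local_max [OF d, of x] x that max by auto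
    ultimately show ?F using x by (auto simp: s_def)
  }
  {
    assume F: ?F
    have "payoff i s y \<le> payoff i s x" if "0 \<le> y" for y
    proof (cases "x = y")
      case False
      then have "payoff i s y < payoff i s x + marginal_payoff i s x * (y - x)"
        using F s that by (intro payoff_lt_tangent) auto
      also have "\<dots> = payoff i s x + marginal_payoff i s x * y"
        using F by (simp add: s_def algebra_simps)
      also have "\<dots> \<le> payoff i s x"
        using F that by (simp add: s_def mult_nonpos_nonneg)
      finally show ?thesis by simp
    qed simp
    then show "best_response utility i r x"
      using F by (auto simp: best_response_utility_iff s_def)
  }
qed

section \<open>The share of a worker as a function of the total rate\<close>

definition excess :: "'n \<Rightarrow> real \<Rightarrow> real \<Rightarrow> real" where
  "excess i S p = Pc * (1 - p) - S * marginal_cost i (p * S)"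

text \<open>The first-order condition as a complementarity problem in the share. It makes sense at
  \<open>S = 0\<close> as well, where it forces \<open>p = 1\<close>.\<close>

definition is_share :: "'n \<Rightarrow> real \<Rightarrow> real \<Rightarrow> bool" where
  "is_share i S p \<longleftrightarrow> 0 \<le> p \<and> p \<le> 1 \<and> excess i S p \<le> 0 \<and> p * excess i S p = 0"

text \<open>With total \<open>S = s + x\<close> and share \<open>p = x / S\<close> one has
  \<open>s = (1 - p) * S\<close>. The extra factor \<open>S\<close> clears the denominators, which
  keeps \<open>excess\<close> continuous at \<open>S = 0\<close>.\<close>

lemma excess_eq_marginal_payoff:
  assumes "0 < s + x"
  shows "excess i (s + x) (x / (s + x)) = (s + x) * marginal_payoff i s x"
  using assms
  by (simp add: excess_def marginal_payoff_def right_diff_distrib power2_eq_square) (simp add: field_simps)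

lemma excess_strict_anti_share:
  assumes "0 \<le> S" "p < q"
  shows "excess i S q < excess i S p"
proof -
  have "S * marginal_cost i (p * S) \<le> S * marginal_cost i (q * S)"
    using assms by (intro mult_left_mono marginal_cost_mono mult_right_mono) auto
  moreover have "Pc * (1 - q) < Pc * (1 - p)" using assms Pc_pos by simp
  ultimately show ?thesis by (simp add: excess_def)
qed

lemma excess_strict_anti_total:
  assumes "0 \<le> S" "S < T" "0 \<le> p"
  shows "excess i T p < excess i S p"
proof -
  have "S * marginal_cost i (p * S) \<le> S * marginal_cost i (p * T)"
    using assms by (intro mult_left_mono marginal_cost_mono) auto
  also have "\<dots> < T * marginal_cost i (p * T)"
    using assms marginal_cost_pos by simp
  finally show ?thesis by (simp add: excess_def)
qed

text \<open>As \<open>q > 0\<close>, complementarity gives \<open>excess i T q = 0\<close>. If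
  \<open>p \<le> q\<close>, the two monotonicities would push this strictly below
  \<open>excess i S p\<close>, which is at most \<open>0\<close>.\<close>

lemma is_share_strict_anti:
  assumes "0 \<le> S" "S < T" "is_share i S p" "is_share i T q" "0 < q"
  shows "q < p"
proof (rule ccontr)
  assume "\<not> q < p"
  then have "excess i S q \<le> excess i S p"
    using excess_strict_anti_share [of S p q i] assms(1) by (cases "p = q") auto
  moreover have "excess i T q < excess i S q"
    using assms by (intro excess_strict_anti_total) auto
  ultimately show False using assms by (auto simp: is_share_def)
qed

text \<open>The larger of two solutions would be positive, hence a zero of \<open>excess\<close>;
  the smaller one would then have positive excess.\<close>

lemma is_share_unique:
  assumes "0 \<le> S" "is_share i S p" "is_share i S q"
  shows "p = q"
proof -
  have False if "is_share i S p" "is_share i S q" "p < q" for p q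
    using excess_strict_anti_share [of S p q i] assms(1) that by (auto simp: is_share_def)
  then show ?thesis using assms by (metis linorder_neqE)
qed

lemma continuous_on_excess:
  "continuous_on A (\<lambda>z. excess i (fst z) (snd z))"
proof -
  have "continuous_on A (\<lambda>z. marginal_cost i (snd z * fst z))"
    by (rule continuous_on_compose2 [OF continuous_on_marginal_cost [of UNIV]])
      (auto intro!: continuous_intros)
  then show ?thesis unfolding excess_def by (intro continuous_intros)
qed

text \<open>Either share \<open>0\<close> already solves the problem, or \<open>excess\<close>
  changes sign on \<open>[0, 1]\<close>: at share \<open>1\<close> only the negative cost term
  remains.\<close>

lemma ex_is_share:
  assumes "0 \<le> S"
  shows "\<exists>p. is_share i S p"
proof (cases "excess i S 0 \<le> 0")
  case True
  then show ?thesis by (auto simp: is_share_def)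
next
  case False
  have "continuous_on {0..1} (\<lambda>p. excess i S p)"
    using continuous_on_compose2 [OF continuous_on_excess [of UNIV i]
        continuous_on_Pair [OF continuous_on_const continuous_on_id]]
    by fastforce
  moreover have "excess i S 1 \<le> 0"
    using assms marginal_cost_pos [of i "1 * S"] by (simp add: excess_def)
  ultimately obtain p where "0 \<le> p" "p \<le> 1" "excess i S p = 0"
    using IVT2' [of "excess i S" 1 0 0] False by auto
  then show ?thesis by (auto simp: is_share_def)
qed

definition share :: "'n \<Rightarrow> real \<Rightarrow> real" where
  "share i S = (THE p. is_share i S p)"

lemma is_share_share: "0 \<le> S \<Longrightarrow> is_share i S (share i S)"
  unfolding share_def by (rule theI') (use ex_is_share is_share_unique in blast)

lemma share_eqI: "0 \<le> S \<Longrightarrow> is_share i S p \<Longrightarrow> share i S = p"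
  using is_share_share is_share_unique by blast

lemma share_at_0: "share i 0 = 1"
  by (rule share_eqI) (auto simp: is_share_def excess_def)

text \<open>For such totals even the first bit costs at least the power it earns. This supplies the
  right endpoint for the intermediate value argument; \<open>share_at_0\<close> supplies the left
  one.\<close>

lemma share_eq_0:
  assumes "Pc / b i \<le> S"
  shows "share i S = 0"
proof -
  have "0 < Pc / b i" using Pc_pos b_pos [of i] by simp
  then have "0 \<le> S" using assms by linarith
  have "Pc \<le> S * b i" using assms b_pos [of i] by (simp add: divide_simps split: if_splits)
  also have "\<dots> \<le> S * marginal_cost i 0"
    using marginal_cost_gt [of i 0] \<open>0 \<le> S\<close> by (intro mult_left_mono) auto
  finally show ?thesis using \<open>0 \<le> S\<close> by (intro share_eqI) (auto simp: is_share_def excess_def)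
qed

text \<open>Closed graph theorem with values in the compact interval \<open>[0, 1]\<close>. By
  uniqueness the graph is the whole solution set of \<open>is_share\<close>, which is cut out by
  closed conditions.\<close>

lemma continuous_on_share: "continuous_on {0..} (share i)"
proof (rule continuous_from_closed_graph)
  show "compact {0..1::real}" by simp
  show "share i \<in> {0..} \<rightarrow> {0..1}"
    using is_share_share by (auto simp: is_share_def)
  have "p = share i S \<longleftrightarrow> is_share i S p" if "0 \<le> S" for S p
    using is_share_share [OF that] share_eqI [OF that] by blast
  then have "(\<lambda>S. (S, share i S)) ` {0..} = {z. 0 \<le> fst z \<and> is_share i (fst z) (snd z)}"
    using is_share_share by (auto simp: image_iff)
  also have "\<dots> =
      ({0..} \<times> {0..1}) \<inter> ({z. excess i (fst z) (snd z) \<le> 0} \<inter> {z. snd z * excess i (fst z) (snd z) = 0})"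
    by (auto simp: is_share_def)
  finally have "(\<lambda>S. (S, share i S)) ` {0..} = \<dots>" .
  moreover have "closed {z. excess i (fst z) (snd z) \<le> 0}"
    by (intro closed_Collect_le continuous_on_excess continuous_intros)
  moreover have "closed {z. snd z * excess i (fst z) (snd z) = 0}"
    by (intro closed_Collect_eq continuous_on_excess continuous_intros)
  ultimately show "closed ((\<lambda>S. (S, share i S)) ` {0..})"
    by (auto intro!: closed_Int closed_Times)
qed

section \<open>Equilibria as totals at which the shares sum to one\<close>

lemma nash_equilibrium_rate_of_others_pos:
  assumes "nash_equilibrium utility r"
  shows "0 < rate_of_others r i"
  using assms no_best_response unfolding nash_equilibrium_iff_best_response by blast

lemma nash_equilibrium_is_share:
  assumes "nash_equilibrium utility r"
  shows "is_share i (\<Sum>j\<in>UNIV. r j) (r i / (\<Sum>j\<in>UNIV. r j))"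
proof -
  define s where "s = rate_of_others r i"
  have s: "0 < s" using nash_equilibrium_rate_of_others_pos [OF assms] by (simp add: s_def)
  have F: "0 \<le> r i" "marginal_payoff i s (r i) \<le> 0" "r i * marginal_payoff i s (r i) = 0"
    using assms s best_response_iff_first_order [of r i "r i"]
    unfolding nash_equilibrium_iff_best_response s_def by auto
  have "(\<Sum>j\<in>UNIV. r j) = s + r i"
    by (simp add: s_def sum_UNIV_eq_rate_of_others [of r i])
  then show ?thesis
    using s F excess_eq_marginal_payoff [of s "r i" i]
    by (auto simp: is_share_def mult_nonneg_nonpos)
qed

lemma nash_equilibrium_of_shares:
  assumes S: "0 < S" and sum: "(\<Sum>i\<in>UNIV. share i S) = 1"
  shows "nash_equilibrium utility (\<lambda>i. share i S * S)"
proof -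
  define r where "r = (\<lambda>i. share i S * S)"
  have sh: "is_share i S (share i S)" for i using S is_share_share by simp
  have total: "(\<Sum>j\<in>UNIV. r j) = S"
    using sum by (simp add: r_def flip: sum_distrib_right)
  have r: "r \<in> profiles"
    using sh S by (auto simp: profiles_def r_def is_share_def)
  have "best_response utility i r (r i)" for i
  proof -
    define s where "s = rate_of_others r i"
    have sS: "s + r i = S" using total sum_UNIV_eq_rate_of_others [of r i] by (simp add: s_def)
    \<comment> \<open>Share \<open>1\<close> would leave a strictly negative excess and violate
      complementarity. Excluding it makes the total of the others positive, as the first-order
      criterion requires.\<close>
    have "share i S \<noteq> 1"
      using sh [of i] S marginal_cost_pos [of i S] by (auto simp: is_share_def excess_def)
    then have "share i S < 1" using sh [of i] by (simp add: is_share_def)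
    then have "r i < S" using S by (simp add: r_def)
    then have s: "0 < s" using sS by simp
    have "excess i S (share i S) = S * marginal_payoff i s (r i)"
      using excess_eq_marginal_payoff [of s "r i" i] sS S by (simp add: r_def)
    then have "marginal_payoff i s (r i) \<le> 0" "r i * marginal_payoff i s (r i) = 0"
      using sh [of i] S by (auto simp: is_share_def r_def mult_le_0_iff)
    then show ?thesis
      using s r by (simp add: best_response_iff_first_order s_def profiles_def)
  qed
  then show ?thesis using r by (simp add: nash_equilibrium_iff_best_response flip: r_def)
qed

text \<open>The sum of the shares runs continuously from the number of workers at
  \<open>S = 0\<close> down to \<open>0\<close>, so it passes through \<open>1\<close>.\<close>

lemma ex_nash_equilibrium:
  assumes "1 < CARD('n)"
  shows "\<exists>r. nash_equilibrium utility r"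
proof -
  \<comment> \<open>A common bound for all thresholds \<open>Pc / b i\<close>; at this total every
    share vanishes.\<close>
  define M where "M = (\<Sum>i\<in>UNIV. Pc / b i)"
  have pos: "0 \<le> Pc / b i" for i using Pc_pos b_pos [of i] by simp
  have "Pc / b i \<le> M" for i
    unfolding M_def by (rule member_le_sum) (auto simp: pos)
  then have M: "(\<Sum>i\<in>UNIV. share i M) = 0" by (simp add: share_eq_0)
  have M0: "0 \<le> M" unfolding M_def by (intro sum_nonneg pos)
  have "continuous_on {0..M} (\<lambda>S. \<Sum>i\<in>UNIV. share i S)"
    by (intro continuous_on_sum continuous_on_subset [OF continuous_on_share]) auto
  then obtain S where S: "0 \<le> S" "(\<Sum>i\<in>UNIV. share i S) = 1"
    using IVT2' [of "\<lambda>S. \<Sum>i\<in>UNIV. share i S" M 1 0] M M0 assms by (auto simp: share_at_0)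
  \<comment> \<open>At \<open>S = 0\<close> the shares sum to the number of workers, which exceeds
    \<open>1\<close>.\<close>
  then have "S \<noteq> 0" using assms by (auto simp: share_at_0)
  then show ?thesis using nash_equilibrium_of_shares [of S] S by auto
qed

text \<open>Of two different totals the larger would give strictly smaller shares to all its active
  workers, although the shares sum to \<open>1\<close> in both equilibria. Equal totals determine
  equal shares.\<close>

lemma nash_equilibrium_unique:
  assumes r: "nash_equilibrium utility r" and q: "nash_equilibrium utility q"
  shows "r = q"
proof -
  have pos: "0 < (\<Sum>j\<in>UNIV. r j)" if "nash_equilibrium utility r" for r
    using nash_equilibrium_rate_of_others_pos [OF that, of undefined] that
    by (simp add: sum_UNIV_eq_rate_of_others [of r undefined] nash_equilibrium_def profiles_def
        add_pos_nonneg)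
  have False if r: "nash_equilibrium utility r" and q: "nash_equilibrium utility q"
    and less: "(\<Sum>j\<in>UNIV. r j) < (\<Sum>j\<in>UNIV. q j)" for r q
  proof -
    define S T where "S = (\<Sum>j\<in>UNIV. r j)" and "T = (\<Sum>j\<in>UNIV. q j)"
    have ST: "0 < S" "0 < T" "S < T" using pos r q less by (auto simp: S_def T_def)
    have sh: "is_share i S (r i / S)" "is_share i T (q i / T)" for i
      using nash_equilibrium_is_share r q by (auto simp: S_def T_def)
    have lt: "q i / T < r i / S" if "0 < q i" for i
      using is_share_strict_anti [OF _ ST(3) sh] ST that by simp
    \<comment> \<open>Workers idle in \<open>q\<close> have share \<open>0\<close> there, so the
      comparison is weak for everyone and strict for the active ones.\<close>
    have le: "q i / T \<le> r i / S" for i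
      using lt [of i] sh(1) [of i] sh(2) [of i] ST
      by (cases "0 < q i") (auto simp: is_share_def zero_le_divide_iff)
    obtain k where "0 < q k"
      using ST(2) by (metis T_def not_less sum_nonpos)
    then have "(\<Sum>i\<in>UNIV. q i / T) < (\<Sum>i\<in>UNIV. r i / S)"
      using le lt by (intro sum_strict_mono_ex1) auto
    then show False using ST by (simp add: S_def T_def flip: sum_divide_distrib)
  qed
  then have eq: "(\<Sum>j\<in>UNIV. r j) = (\<Sum>j\<in>UNIV. q j)" using r q by (metis linorder_neqE)
  have "r i = q i" for i
    using is_share_unique [OF _ nash_equilibrium_is_share [OF r, of i]]
      nash_equilibrium_is_share [OF q, of i] pos [OF r] eq by fastforce
  then show ?thesis by auto
qed

text \<open>A positive total of the others presupposes a second worker, which is what existence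
  requires.\<close>

lemma ex1_nash_equilibrium:
  fixes r :: "'n \<Rightarrow> real"
  assumes "0 < rate_of_others r i"
  shows "\<exists>!r. nash_equilibrium utility r"
proof -
  have "UNIV - {i} \<noteq> {}"
    using assms unfolding rate_of_others_def by force
  then obtain j where "j \<noteq> i" by auto
  have "card {i, j} \<le> CARD('n)" by (intro card_mono) auto
  then have "1 < CARD('n)" using \<open>j \<noteq> i\<close> by simp
  then show ?thesis using ex_nash_equilibrium nash_equilibrium_unique by blast
qed

section \<open>The second partial derivatives and their quadratic form\<close>

lemma partial_deriv_utility:
  assumes "0 < (\<Sum>k\<in>UNIV. r k)"
  shows "partial_deriv j (utility i) r =
    (if i = j then marginal_payoff i (rate_of_others r i) (r i)
     else - Pc * r i / (\<Sum>k\<in>UNIV. r k)\<^sup>2)"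
proof (cases "i = j")
  case True
  have "0 < rate_of_others r i + r i" using assms by (simp add: sum_UNIV_eq_rate_of_others [of r i])
  then show ?thesis
    using True payoff_has_derivative [of "rate_of_others r i" "r i" i]
    by (simp add: partial_deriv_def utility_upd DERIV_imp_deriv)
next
  case False
  have S: "(\<Sum>k\<in>UNIV. r k) = rate_of_others r j + r j" by (rule sum_UNIV_eq_rate_of_others)
  have "utility i (r(j := t)) = r i / (rate_of_others r j + t) * Pc - cost i (r i)" for t
    unfolding worker_utility_def cost_def
    by (subst sum_UNIV_eq_rate_of_others [of _ j]) (simp add: False)
  moreover have "((\<lambda>t. r i / (rate_of_others r j + t) * Pc - cost i (r i)) has_real_derivative
      - Pc * r i / (\<Sum>k\<in>UNIV. r k)\<^sup>2) (at (r j))"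
    by (rule derivative_eq_intros refl | use assms S in \<open>simp add: power2_eq_square\<close>)+
  ultimately show ?thesis using False by (simp add: partial_deriv_def DERIV_imp_deriv)
qed

lemma second_partials_utility:
  assumes "0 < (\<Sum>k\<in>UNIV. r k)"
  shows "second_partials utility r $ i $ j =
    Pc * (2 * r i - (\<Sum>k\<in>UNIV. r k)) / (\<Sum>k\<in>UNIV. r k) ^ 3
    - (if i = j then Pc / (\<Sum>k\<in>UNIV. r k)\<^sup>2 + cost_curvature i (r i) else 0)"
    (is "_ = ?R")
proof -
  define s where "s = rate_of_others r i"
  \<comment> \<open>The inner partial derivative in direction \<open>j\<close>, viewed as a function
    of the rate of worker \<open>i\<close>.\<close>
  define F where "F t = (if i = j then marginal_payoff i s t else - Pc * t / (s + t)\<^sup>2)" for t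
  have S: "(\<Sum>k\<in>UNIV. r k) = s + r i" by (simp add: s_def sum_UNIV_eq_rate_of_others [of r i])
  have pos: "0 < s + r i" using assms S by simp
  have "(F has_real_derivative ?R) (at (r i))"
  proof (cases "i = j")
    case True
    have "((\<lambda>t. Pc * s / (s + t)\<^sup>2) has_real_derivative - 2 * Pc * s / (s + r i) ^ 3) (at (r i))"
      by (rule derivative_eq_intros refl
          | use pos in \<open>simp add: divide_simps power2_eq_square power3_eq_cube\<close>)+
    from DERIV_diff [OF this marginal_cost_has_derivative, of i]
    have "(F has_real_derivative - 2 * Pc * s / (s + r i) ^ 3 - cost_curvature i (r i)) (at (r i))"
      using True by (simp add: F_def [abs_def] marginal_payoff_def [abs_def])
    moreover have "- 2 * Pc * s / (s + r i) ^ 3 = Pc * (2 * r i - (s + r i)) / (s + r i) ^ 3 - Pc / (s + r i)\<^sup>2"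
      using pos by (simp add: divide_simps) algebra
    ultimately show ?thesis using True by (simp add: S diff_diff_add)
  next
    case False
    have "((\<lambda>t. - Pc * t / (s + t)\<^sup>2) has_real_derivative
        Pc * (2 * r i - (s + r i)) / (s + r i) ^ 3) (at (r i))"
      using pos by (auto intro!: derivative_eq_intros simp: divide_simps) algebra
    then show ?thesis using False by (simp add: S F_def [abs_def])
  qed
  \<comment> \<open>The formula for the inner derivative holds while the total rate is positive.
    That is an open set of \<open>t\<close> around \<open>r i\<close>, which suffices for
    differentiating again.\<close>
  moreover have "partial_deriv j (utility i) (r(i := t)) = F t" if "t \<in> {- s<..}" for t
  proof -
    have "(\<Sum>k\<in>UNIV. (r(i := t)) k) = s + t"
      by (subst sum_UNIV_eq_rate_of_others [of _ i]) (simp add: s_def)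
    then show ?thesis
      using partial_deriv_utility [of "r(i := t)" j i] that by (simp add: F_def s_def)
  qed
  ultimately have "((\<lambda>t. partial_deriv j (utility i) (r(i := t))) has_real_derivative ?R) (at (r i))"
    using pos has_field_derivative_transform_within_open [of F ?R "r i" "{- s<..}"] by fastforce
  then show ?thesis
    by (simp add: second_partials_def partial_deriv_def [of i] DERIV_imp_deriv)
qed

lemma quadratic_form_second_partials_neg:
  assumes r: "r \<in> profiles" and pos: "0 < (\<Sum>k\<in>UNIV. r k)" and "x \<noteq> 0"
  shows "x \<bullet> (second_partials utility r *v x) < 0"
proof -
  define S where "S = (\<Sum>k\<in>UNIV. r k)"
  define X where "X = (\<Sum>i\<in>UNIV. x $ i)"
  define m where "m = (\<Sum>i\<in>UNIV. r i * x $ i)"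
  define Q where "Q = (\<Sum>i\<in>UNIV. (x $ i)\<^sup>2)"
  define E where "E = (\<Sum>i\<in>UNIV. cost_curvature i (r i) * (x $ i)\<^sup>2)"
  have S: "0 < S" using pos by (simp add: S_def)
  have "x \<bullet> (second_partials utility r *v x) =
      (\<Sum>i\<in>UNIV. \<Sum>j\<in>UNIV. Pc / S ^ 3 * ((2 * r i - S) * x $ i * x $ j)
        - (if i = j then Pc / S\<^sup>2 * (x $ i)\<^sup>2 + cost_curvature i (r i) * (x $ i)\<^sup>2 else 0))"
    unfolding quadratic_form_eq_sum second_partials_utility [OF pos] S_def [symmetric]
    by (intro sum.cong refl) (auto simp: algebra_simps power2_eq_square add_divide_distrib diff_divide_distrib)
  also have "\<dots> = (\<Sum>i\<in>UNIV. Pc / S ^ 3 * ((2 * r i - S) * x $ i * X)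
        - (Pc / S\<^sup>2 * (x $ i)\<^sup>2 + cost_curvature i (r i) * (x $ i)\<^sup>2))"
    by (simp add: sum_subtractf X_def sum_distrib_left)
  also have "\<dots> = Pc / S ^ 3 * ((2 * m - S * X) * X) - Pc / S\<^sup>2 * Q - E"
    by (simp add: sum_subtractf sum.distrib m_def Q_def E_def X_def sum_distrib_left sum_distrib_right
        algebra_simps)
  \<comment> \<open>Pulling out \<open>Pc / S ^ 4\<close> prepares for completing the square in
    \<open>S * X - m\<close>.\<close>
  also have "\<dots> = Pc / S ^ 4 * (2 * (S * X) * m - (S * X)\<^sup>2 - S\<^sup>2 * Q) - E"
    using S by (simp add: field_simps power2_eq_square power3_eq_cube power4_eq_xxxx)
  also have "\<dots> < 0"
  proof -
    have "m\<^sup>2 \<le> S\<^sup>2 * Q"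
      unfolding m_def S_def Q_def by (rule sum_mult_squared_le [OF r])
    moreover have "0 \<le> (S * X - m)\<^sup>2" by simp
    ultimately have "2 * (S * X) * m - (S * X)\<^sup>2 - S\<^sup>2 * Q \<le> 0"
      by (simp add: power2_diff)
    then have "Pc / S ^ 4 * (2 * (S * X) * m - (S * X)\<^sup>2 - S\<^sup>2 * Q) \<le> 0"
      using Pc_pos S by (intro mult_nonneg_nonpos) auto
    \<comment> \<open>The power term is only shown to be nonpositive; strictness comes from the
      curvature of the energy cost.\<close>
    moreover have "0 < E"
    proof -
      obtain k where "x $ k \<noteq> 0" using \<open>x \<noteq> 0\<close> by (auto simp: vec_eq_iff)
      then show ?thesis
        unfolding E_def using cost_curvature_pos
        by (intro sum_pos2 [of _ k]) (auto simp: less_imp_le)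
    qed
    ultimately show ?thesis by linarith
  qed
  finally show ?thesis .
qed

text \<open>A matrix and its transpose have the same quadratic form, so symmetrizing just doubles
  it.\<close>

lemma negative_definite_second_partials:
  assumes "r \<in> profiles" "0 < (\<Sum>k\<in>UNIV. r k)"
  shows "negative_definite (second_partials utility r + transpose (second_partials utility r))"
  unfolding negative_definite_def
proof (intro conjI allI impI)
  let ?H = "second_partials utility r"
  show "transpose (?H + transpose ?H) = ?H + transpose ?H"
    by (simp add: vec_eq_iff transpose_def)
  fix x :: "real ^ 'n"
  assume "x \<noteq> 0"
  from quadratic_form_second_partials_neg [OF assms this]
  show "x \<bullet> ((?H + transpose ?H) *v x) < 0"
    by (simp add: matrix_vector_mult_add_rdistrib inner_add_right quadratic_form_transpose
        del: transpose_matrix_vector)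
qed

end

theorem mainTheorem1:
  fixes Pc B g \<alpha> :: real
    and D b :: "'n::finite \<Rightarrow> real"
    and u :: "'n \<Rightarrow> ('n \<Rightarrow> real) \<Rightarrow> real"
    and H :: "('n \<Rightarrow> real) \<Rightarrow> real ^ 'n ^ 'n"
  assumes "Pc > 0" and "B > 0" and "g > 0" and "\<alpha> \<ge> 2"
    and "\<And>i. D i > 0" and "\<And>i. b i > 0"
    and u: "u = worker_utility Pc B g \<alpha> D b"
    and H: "H = second_partials u"
  shows
    "(\<forall>i. \<forall>r\<in>profiles. strictly_concave_on {0..} (\<lambda>x. u i (r(i := x)))) \<and>
     concave_game u \<and>
     ((\<exists>r\<in>(profiles :: ('n \<Rightarrow> real) set). \<forall>i. rate_of_others r i > 0) \<longrightarrow>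
        (\<exists>r. nash_equilibrium u r \<and> (\<forall>i. rate_of_others r i > 0))) \<and>
     (\<forall>i. \<forall>r\<in>profiles. \<not> rate_of_others r i > 0 \<longrightarrow> \<not> (\<exists>x. best_response u i r x)) \<and>
     (\<forall>i. \<forall>r\<in>profiles. rate_of_others r i > 0 \<longrightarrow> (\<exists>!x. best_response u i r x)) \<and>
     (\<forall>r\<in>profiles. (\<Sum>j\<in>UNIV. r j) > 0 \<and> (\<forall>i. r i \<le> rate_of_others r i) \<longrightarrow>
        negative_definite (H r + transpose (H r)) \<and>
        (\<exists>!r'. nash_equilibrium u r'))"
proof -
  interpret rate_game Pc B g \<alpha> D b
    using assms by unfold_locales auto
  \<comment> \<open>A worker with positive rate is dominated by a positive total of the others; for
    an idle worker the others carry the whole positive total.\<close>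
  have others_pos: "rate_of_others r i > 0"
    if "r \<in> profiles" "(\<Sum>j\<in>UNIV. r j) > 0" "\<forall>i. r i \<le> rate_of_others r i" for r :: "'n \<Rightarrow> real" and i
  proof -
    have "0 \<le> r i" "r i \<le> rate_of_others r i" using that by (auto simp: profiles_def)
    then show ?thesis using that(2) sum_UNIV_eq_rate_of_others [of r i] by linarith
  qed
  show ?thesis
    unfolding H u
  proof (intro conjI allI ballI impI)
    show "\<exists>r. nash_equilibrium utility r \<and> (\<forall>i. rate_of_others r i > 0)"
      if "\<exists>r\<in>(profiles :: ('n \<Rightarrow> real) set). \<forall>i. rate_of_others r i > 0"
      using that ex1_nash_equilibrium nash_equilibrium_rate_of_others_pos by metis
    show "\<exists>!r'. nash_equilibrium utility r'"
      if "r \<in> profiles" "(\<Sum>j\<in>UNIV. r j) > 0 \<and> (\<forall>i. r i \<le> rate_of_others r i)"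
      for r :: "'n \<Rightarrow> real"
      using ex1_nash_equilibrium [OF others_pos] that by simp
  qed (simp_all add: strictly_concave_utility concave_game_utility no_best_response
      ex1_best_response negative_definite_second_partials)
qed

end
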